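(* Let $(M;\oplus,',0,1)$ be an MV-algebra with a square root $r:M\to M$, let $(G,u)$ be its corresponding Abelian unital $\ell$-group (so $M=\Gamma(G,u)$, $1=u$), and set $w=r(0)'\odot r(0)'$. Then, for each $x\in M$, the element $(x\wedge w)\vee\bigl(((x\wedge w')+w')/2\bigr)$ exists in $M$, and $$r(x)=(x\wedge w)\vee\bigl(((x\wedge w')+w')/2\bigr),$$ where $+$ is the addition in the group $G$.
   Context: A unital $\ell$-group $(G,u)$ is an Abelian lattice-ordered group $G$ with a fixed strong unit $u\ge 0$. $\Gamma(G,u)=([0,u];\oplus,',0,u)$ is the MV-algebra on the interval $[0,u]$ with $x\oplus y=(x+y)\wedge u$, $x'=u-x$; every MV-algebra is isomorphic to $\Gamma(G,u)$ for a unital $\ell$-group $(G,u)$ (unique up to isomorphism). In an MV-algebra $x\odot y=(x'\oplus y')'$. A square root on an MV-algebra $M$ is a map $r:M\to M$ such that $r(x)\odot r(x)=x$ for all $x\in M$, and for all $x,y\in M$, $y\odot y\le x$ implies $y\le r(x)$. For $g\in G$, $g/2$ denotes the unique $h\in G$ with $h+h=g$, if it exists (Abelian $\ell$-groups have unique extraction of roots). *)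

theory Defs
  imports Complex_Main "HOL-Library.Lattice_Algebras"
begin

record 'a mv_structure =
  mv_carrier :: "'a set"
  mv_plus :: "'a \<Rightarrow> 'a \<Rightarrow> 'a"
  mv_neg :: "'a \<Rightarrow> 'a"
  mv_zero :: 'a
  mv_one :: 'a

definition mv_algebra :: "'a mv_structure \<Rightarrow> bool" where
  "mv_algebra M \<longleftrightarrow>
     (\<forall>x\<in>mv_carrier M. \<forall>y\<in>mv_carrier M. mv_plus M x y \<in> mv_carrier M) \<and>
     (\<forall>x\<in>mv_carrier M. mv_neg M x \<in> mv_carrier M) \<and>
     mv_zero M \<in> mv_carrier M \<and>
     mv_one M \<in> mv_carrier M \<and>
     (\<forall>x\<in>mv_carrier M. \<forall>y\<in>mv_carrier M. \<forall>z\<in>mv_carrier M.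
        mv_plus M (mv_plus M x y) z = mv_plus M x (mv_plus M y z)) \<and>
     (\<forall>x\<in>mv_carrier M. \<forall>y\<in>mv_carrier M. mv_plus M x y = mv_plus M y x) \<and>
     (\<forall>x\<in>mv_carrier M. mv_plus M x (mv_zero M) = x) \<and>
     (\<forall>x\<in>mv_carrier M. mv_neg M (mv_neg M x) = x) \<and>
     mv_neg M (mv_zero M) = mv_one M \<and>
     (\<forall>x\<in>mv_carrier M. mv_plus M x (mv_one M) = mv_one M) \<and>
     (\<forall>x\<in>mv_carrier M. \<forall>y\<in>mv_carrier M.
        mv_plus M (mv_neg M (mv_plus M (mv_neg M x) y)) y =
        mv_plus M (mv_neg M (mv_plus M (mv_neg M y) x)) x)"

definition mv_times :: "'a mv_structure \<Rightarrow> 'a \<Rightarrow> 'a \<Rightarrow> 'a" where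
  "mv_times M x y = mv_neg M (mv_plus M (mv_neg M x) (mv_neg M y))"

text \<open>The natural order of an MV-algebra; on \<open>\<Gamma>(G,u)\<close> it is the group order,
  see \<open>mv_le_Gamma\<close> below.\<close>

definition mv_le :: "'a mv_structure \<Rightarrow> 'a \<Rightarrow> 'a \<Rightarrow> bool" where
  "mv_le M x y \<longleftrightarrow> mv_plus M (mv_neg M x) y = mv_one M"

definition mv_square_root :: "'a mv_structure \<Rightarrow> ('a \<Rightarrow> 'a) \<Rightarrow> bool" where
  "mv_square_root M r \<longleftrightarrow>
     (\<forall>x\<in>mv_carrier M. r x \<in> mv_carrier M) \<and>
     (\<forall>x\<in>mv_carrier M. mv_times M (r x) (r x) = x) \<and>
     (\<forall>x\<in>mv_carrier M. \<forall>y\<in>mv_carrier M.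
        mv_le M (mv_times M y y) x \<longrightarrow> mv_le M y (r x))"

definition strong_unit :: "'g::lattice_ab_group_add \<Rightarrow> bool" where
  "strong_unit u \<longleftrightarrow> 0 \<le> u \<and> (\<forall>g. \<exists>n::nat. g \<le> (\<Sum>i<n. u))"

definition Gamma :: "'g::lattice_ab_group_add \<Rightarrow> 'g mv_structure" where
  "Gamma u = \<lparr> mv_carrier = {0..u}, mv_plus = (\<lambda>x y. inf (x + y) u),
               mv_neg = (\<lambda>x. u - x), mv_zero = 0, mv_one = u \<rparr>"

text \<open>\<open>group_half g\<close> is meaningful only if \<open>g\<close> has a half; it is then unique by
  \<open>group_half_unique\<close>.\<close>

definition group_half :: "'g::lattice_ab_group_add \<Rightarrow> 'g" where
  "group_half g = (THE h. h + h = g)"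

lemma group_half_unique:
  fixes h k :: "'g::lattice_ab_group_add"
  assumes "h + h = k + k"
  shows "h = k"
proof -
  have "(h - k) + (h - k) = 0"
    using assms by (simp add: algebra_simps)
  then show ?thesis by (simp only: double_zero) simp
qed

lemma group_half_eq: "h + h = g \<Longrightarrow> group_half g = h"
  for g h :: "'g::lattice_ab_group_add"
  unfolding group_half_def by (rule the_equality) (auto intro: group_half_unique)

lemma mv_le_Gamma: "mv_le (Gamma u) x y \<longleftrightarrow> x \<le> y"
proof -
  have "inf (u - x + y) u = u \<longleftrightarrow> u \<le> u - x + y" by (metis inf.absorb_iff2)
  also have "\<dots> \<longleftrightarrow> x \<le> y"
    by (metis add_le_cancel_left diff_add_cancel diff_add_eq add.commute)
  finally show ?thesis by (simp add: mv_le_def Gamma_def)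
qed

lemma mv_algebra_Gamma:
  fixes u :: "'g::lattice_ab_group_add"
  assumes "0 \<le> u"
  shows "mv_algebra (Gamma u)"
proof -
  have sup: "inf (u - inf (u - x + y) u + y) u = sup x y" if "x \<le> u" "0 \<le> y" "y \<le> u" for x y :: 'g
  proof -
    have "u - inf (u - x + y) u + y = sup x y"
    proof -
      have "u - inf (u - x + y) u + y = (u + y) + sup (- (u - x + y)) (- u)"
        by (simp add: neg_inf_eq_sup algebra_simps del: minus_diff_eq)
      also have "\<dots> = sup ((u + y) + (- (u - x + y))) ((u + y) + - u)"
        by (rule add_sup_distrib_left)
      also have "\<dots> = sup x y" by simp
      finally show ?thesis .
    qed
    then show ?thesis using that by (simp add: inf.absorb1)
  qed
  have assoc: "inf (inf (x + y) u + z) u = inf (x + inf (y + z) u) u"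
    if "0 \<le> x" "0 \<le> z" for x y z :: 'g
  proof -
    have "inf (inf (x + y) u + z) u = inf (x + y + z) (inf (u + z) u)"
      by (simp add: add_inf_distrib_right inf_assoc)
    also have "inf (u + z) u = u" using that by (simp add: inf.absorb2)
    also have "inf (x + y + z) u = inf (x + y + z) (inf (x + u) u)"
      using that by (simp add: inf.absorb2)
    also have "\<dots> = inf (x + inf (y + z) u) u"
      by (simp add: add_inf_distrib_left inf_assoc add.assoc)
    finally show ?thesis .
  qed
  have lukasiewicz: "inf (u - inf (u - x + y) u + y) u = inf (u - inf (u - y + x) u + x) u"
    if "0 \<le> x" "x \<le> u" "0 \<le> y" "y \<le> u" for x y :: 'g
    using that by (simp only: sup sup.commute)
  show ?thesis
    unfolding mv_algebra_def Gamma_def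
    using assms
    by (intro conjI ballI)
      ((simp add: assoc lukasiewicz inf.absorb1 inf.absorb2 del: minus_diff_eq diff_inf_eq_sup; fail)
        | (simp add: add.commute; fail))+
qed

end

theory Submission
  imports Defs
begin

text \<open>
  Put \<open>a = r 0\<close>, so that \<open>w = u - 2a\<close> and \<open>w' = 2a\<close>. For \<open>s = r (2a)\<close> the element
  \<open>(s - a) \<sqinter> (u - (s - a))\<close> squares to \<open>0\<close>, hence is at most \<open>a\<close>; together with
  \<open>2s - u \<le> 2a\<close> this forces \<open>s \<le> 2a\<close>, and then \<open>(2s - u)\<^sup>+ = 2a\<close> yields \<open>w \<sqinter> w' = 0\<close>.
  So every element of \<open>[0, u]\<close> splits along \<open>w\<close> and \<open>w'\<close>. On the \<open>w'\<close> part \<open>r x \<ge> a\<close>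
  gives \<open>2 r x - u = x\<close>; on the \<open>w\<close> part \<open>r x \<sqinter> (u - r x) \<le> a\<close> shows that \<open>r x\<close> is
  complemented, hence equal to its own square \<open>x\<close>.
\<close>

lemma sup_diff_zero: "sup (b - c) 0 = b - inf b c"
  for b c :: "'g::lattice_ab_group_add"
proof -
  have "b - inf b c = b + sup (- b) (- c)" by (simp add: neg_inf_eq_sup)
  also have "\<dots> = sup (b + - b) (b + - c)" by (rule add_sup_distrib_left)
  finally show ?thesis by (simp add: sup.commute)
qed

lemma inf_add_le:
  fixes b c d :: "'g::lattice_ab_group_add"
  assumes "0 \<le> b"
  shows "inf (b + d) c \<le> b + inf d c"
proof -
  have "c \<le> b + c" using assms by simp
  then show ?thesis
    unfolding add_inf_distrib_left by (metis inf.cobounded1 inf.coboundedI2 inf.cobounded2 le_infI)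
qed

lemma inf_zero_mono:
  fixes b c d e :: "'g::lattice_ab_group_add"
  assumes "inf b c = 0" "0 \<le> d" "d \<le> b" "0 \<le> e" "e \<le> c"
  shows "inf d e = 0"
  using assms inf_mono[of d b e c] by (intro antisym) auto

text \<open>By \<open>inf_add_le\<close>, the meet is at most \<open>b + inf d c = b\<close>; being
  also at most \<open>c\<close>, it lies below \<open>inf b c = 0\<close>.\<close>

lemma inf_add_zero:
  fixes b c d :: "'g::lattice_ab_group_add"
  assumes "inf b c = 0" "inf d c = 0"
  shows "inf (b + d) c = 0"
proof (rule antisym)
  have nonneg: "0 \<le> b" "0 \<le> c" "0 \<le> d" using assms by (metis inf.cobounded1 inf.cobounded2)+
  have "inf (b + d) c \<le> b" using inf_add_le[OF nonneg(1), of d c] assms(2) by simp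
  then have "inf (b + d) c \<le> inf b c" by simp
  then show "inf (b + d) c \<le> 0" using assms(1) by simp
  show "0 \<le> inf (b + d) c" using nonneg by simp
qed

lemma inf_add_absorb:
  fixes p v w :: "'g::lattice_ab_group_add"
  assumes "0 \<le> p" "p \<le> w" "0 \<le> v" "inf v w = 0"
  shows "inf (p + v) w = p"
  using inf_add_le[of p v w] assms by (intro antisym) auto

text \<open>Distributing the sum of the two meets gives the meet of \<open>s + s\<close>,
  \<open>s + w'\<close>, \<open>w + s\<close> and \<open>w + w'\<close>, all at least
  \<open>s\<close>. Disjointness turns this sum into a join, which is at most
  \<open>s\<close>.\<close>

lemma split_along_complement:
  fixes s w w' :: "'g::lattice_ab_group_add"
  assumes "inf w w' = 0" "0 \<le> s" "s \<le> w + w'"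
  shows "inf s w + inf s w' = s" and "sup (inf s w) (inf s w') = s"
proof -
  have nonneg: "0 \<le> w" "0 \<le> w'" using assms(1) by (metis inf.cobounded1 inf.cobounded2)+
  have disjoint: "inf (inf s w) (inf s w') = 0"
    by (rule inf_zero_mono[OF assms(1)]) (use assms nonneg in auto)
  have sum: "inf s w + inf s w' = sup (inf s w) (inf s w')"
    using add_eq_inf_sup[of "inf s w" "inf s w'"] disjoint by simp
  have "s \<le> inf s w + inf s w'"
    unfolding add_inf_distrib_left add_inf_distrib_right
    using assms nonneg by (simp add: add_increasing add_increasing2)
  with sum show "sup (inf s w) (inf s w') = s" by (intro antisym) auto
  with sum show "inf s w + inf s w' = s" by simp
qed

lemma mv_times_Gamma: "mv_times (Gamma u) x y = sup (x + y - u) 0"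
  for u x y :: "'g::lattice_ab_group_add"
proof -
  have "mv_times (Gamma u) x y = u - inf u (u - x + (u - y))"
    by (simp add: mv_times_def Gamma_def inf.commute)
  also have "\<dots> = sup (u - (u - x + (u - y))) 0" by (rule sup_diff_zero[symmetric])
  also have "u - (u - x + (u - y)) = x + y - u" by (simp add: algebra_simps)
  finally show ?thesis .
qed

locale gamma_square_root =
  fixes u :: "'g::lattice_ab_group_add" and r :: "'g \<Rightarrow> 'g"
  assumes square_root: "mv_square_root (Gamma u) r"
    and unit_nonneg: "0 \<le> u"
begin

lemma
  assumes "0 \<le> x" "x \<le> u"
  shows root_nonneg: "0 \<le> r x"
    and root_le_unit: "r x \<le> u"
    and root_square: "sup (r x + r x - u) 0 = x"
  using square_root assms unfolding mv_square_root_def mv_times_Gamma by (auto simp: Gamma_def)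

lemma root_greatest:
  assumes "0 \<le> x" "x \<le> u" "0 \<le> y" "y \<le> u" "y + y - u \<le> x"
  shows "y \<le> r x"
  using square_root assms unfolding mv_square_root_def mv_times_Gamma mv_le_Gamma
  by (auto simp: Gamma_def)

lemma root_zero_nonneg: "0 \<le> r 0"
  using root_nonneg[of 0] unit_nonneg by simp

lemma twice_root_zero_le: "r 0 + r 0 \<le> u"
  using root_square[of 0] unit_nonneg by (metis diff_le_0_iff_le order_refl sup.cobounded1)

text \<open>The bound \<open>y + y \<le> u\<close> says that \<open>y\<close> squares to
  \<open>0\<close>, and \<open>r 0\<close> is the greatest such element.\<close>

lemma le_root_zero:
  assumes "0 \<le> y" "y + y \<le> u"
  shows "y \<le> r 0"
proof (rule root_greatest)
  show "y \<le> u" using assms by (metis add_increasing order_trans order_refl add.right_neutral add_left_mono)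
qed (use assms unit_nonneg in auto)

text \<open>Twice the meet is at most \<open>y + (u - y) = u\<close>. This is applied to
  \<open>s - r 0\<close> and to \<open>r x\<close>.\<close>

lemma inf_complement_le_root_zero:
  assumes "0 \<le> y" "y \<le> u"
  shows "inf y (u - y) \<le> r 0"
proof (rule le_root_zero)
  have "inf y (u - y) + inf y (u - y) \<le> y + (u - y)"
    by (rule add_mono) auto
  then show "inf y (u - y) + inf y (u - y) \<le> u" by simp
qed (use assms in auto)

lemma root_zero_le_root:
  assumes "0 \<le> x" "x \<le> u"
  shows "r 0 \<le> r x"
proof (rule root_greatest)
  show "r 0 \<le> u" using root_le_unit[of 0] unit_nonneg by simp
  show "r 0 + r 0 - u \<le> x" using twice_root_zero_le assms by (simp add: order_trans[of _ 0])
qed (use assms root_zero_nonneg in auto)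

lemma unit_diff_twice_root_zero_disjoint: "inf (u - (r 0 + r 0)) (r 0 + r 0) = 0"
proof (rule antisym)
  define b where "b = r 0 + r 0"
  define s where "s = r b"
  have b: "0 \<le> b" "b \<le> u"
    using root_zero_nonneg twice_root_zero_le by (simp_all add: b_def)
  have s: "r 0 \<le> s" "s \<le> u" and square: "sup (s + s - u) 0 = b"
    using b unfolding s_def by (simp_all add: root_zero_le_root root_le_unit root_square)
  have "s - r 0 \<le> u"
    using s(2) root_zero_nonneg by (metis diff_left_mono diff_zero order_trans)
  then have "inf (s - r 0) (u - (s - r 0)) \<le> r 0"
    using s by (intro inf_complement_le_root_zero) auto
  moreover have "s - r 0 \<le> u - (s - r 0)"
  proof -
    have "s + s - u \<le> r 0 + r 0" using square b_def by (metis sup.cobounded1)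
    then show ?thesis by (simp add: algebra_simps)
  qed
  \<comment> \<open>The meet collapses to its first argument, so
    \<open>s - r 0 \<le> r 0\<close>.\<close>
  ultimately have s_le: "s \<le> b" by (simp add: b_def inf.absorb1 algebra_simps)
  \<comment> \<open>Shifting the square equation by \<open>- b\<close> and then negating it turns it
    into a disjointness from \<open>b\<close>.\<close>
  have "b + sup (s + s - u - b) (- b) = sup (b + (s + s - u - b)) (b + - b)"
    by (rule add_sup_distrib_left)
  then have "sup (s + s - u - b) (- b) = 0" using square by simp
  then have "inf (u + b - (s + s)) b = 0"
    using neg_sup_eq_inf[of "s + s - u - b" "- b"] by (simp add: algebra_simps)
  \<comment> \<open>Hence \<open>u - b\<close> inherits the disjointness from
    \<open>b\<close>.\<close>
  moreover have "u - b \<le> u + b - (s + s)"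
  proof -
    have "s + s \<le> b + b" using s_le by (intro add_mono)
    then show ?thesis by (simp add: algebra_simps)
  qed
  ultimately show "inf (u - (r 0 + r 0)) (r 0 + r 0) \<le> 0"
    unfolding b_def[symmetric] by (metis inf_mono order_refl)
  show "0 \<le> inf (u - (r 0 + r 0)) (r 0 + r 0)"
    using b by (simp add: b_def)
qed

context
  fixes w w' x :: 'g
  assumes w': "w' = r 0 + r 0" and w: "w = u - w'" and x: "0 \<le> x" "x \<le> u"
begin

lemma complement_disjoint: "inf w w' = 0"
  using unit_diff_twice_root_zero_disjoint by (simp add: w w')

lemma complement_nonneg: "0 \<le> w" "0 \<le> w'"
  using complement_disjoint by (metis inf.cobounded1 inf.cobounded2)+

lemma root_split: "inf (r x) w + inf (r x) w' = r x" "sup (inf (r x) w) (inf (r x) w') = r x"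
  using split_along_complement[OF complement_disjoint, of "r x"] root_nonneg[OF x] root_le_unit[OF x]
  by (simp_all add: w)

text \<open>The meet lies below \<open>w\<close>, and also below
  \<open>inf (r x) (u - r x) \<le> r 0 \<le> w'\<close>, while \<open>w\<close> and
  \<open>w'\<close> are disjoint.\<close>

lemma root_part_complemented: "inf (inf (r x) w) (w - inf (r x) w) = 0"
proof (rule antisym)
  \<comment> \<open>The added summand is nonnegative and completes the difference to
    \<open>u - r x\<close>.\<close>
  have "w - inf (r x) w \<le> (w - inf (r x) w) + (w' - inf (r x) w')"
    by (simp del: diff_inf_eq_sup)
  also have "\<dots> = (w + w') - (inf (r x) w + inf (r x) w')" by (simp only: add_diff_add)
  also have "\<dots> = u - r x" by (simp only: root_split) (simp add: w)
  finally have "inf (inf (r x) w) (w - inf (r x) w) \<le> inf (r x) (u - r x)"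
    by (intro inf_mono) auto
  also have "\<dots> \<le> r 0" using x by (intro inf_complement_le_root_zero root_nonneg root_le_unit)
  also have "\<dots> \<le> w'" using root_zero_nonneg by (simp add: w')
  finally have "inf (inf (r x) w) (w - inf (r x) w) \<le> inf w w'" by (simp add: le_infI1)
  then show "inf (inf (r x) w) (w - inf (r x) w) \<le> 0" using complement_disjoint by simp
  show "0 \<le> inf (inf (r x) w) (w - inf (r x) w)"
    using root_nonneg[OF x] complement_nonneg by (simp del: diff_inf_eq_sup)
qed

text \<open>With \<open>r x = p + q\<close> split along \<open>w\<close> and \<open>w'\<close>, the
  square of \<open>r x\<close> is computed to be \<open>p + v\<close>, where
  \<open>v = q + q - w'\<close>. Meeting \<open>x = p + v\<close> with \<open>w\<close> and
  \<open>w'\<close> then reads off \<open>p\<close> and \<open>v\<close>.\<close>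

lemma
  shows inf_root_complement: "inf (r x) w = inf x w"
    and twice_inf_root: "inf (r x) w' + inf (r x) w' = inf x w' + w'"
proof -
  define p q v where "p = inf (r x) w" and "q = inf (r x) w'" and "v = q + q - w'"
  have p: "0 \<le> p" "p \<le> w" and q: "0 \<le> q" "q \<le> w'"
    using root_nonneg[OF x] complement_nonneg by (auto simp: p_def q_def)
  \<comment> \<open>As \<open>w'\<close> is twice \<open>r 0\<close>, this makes \<open>v\<close>
    nonnegative.\<close>
  have "r 0 \<le> q"
    using root_zero_le_root[OF x] root_zero_nonneg by (simp add: q_def w')
  then have "0 \<le> v" unfolding v_def w' by (simp add: add_mono)
  moreover have "v \<le> w'" using q by (simp add: v_def diff_le_eq add_mono)
  ultimately have v: "0 \<le> v" "v \<le> w'" .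
  have v_disjoint: "inf v d = 0" if "0 \<le> d" "d \<le> w" for d
    by (rule inf_zero_mono[OF _ v that]) (simp add: complement_disjoint inf.commute)
  have "r x = p + q" using root_split(1) by (simp add: p_def q_def)
  then have "r x + r x - u = (p + v) - (w - p)" by (simp add: w v_def algebra_simps)
  then have "x = sup ((p + v) - (w - p)) 0" using root_square[OF x] by simp
  also have "\<dots> = (p + v) - inf (p + v) (w - p)" by (rule sup_diff_zero)
  \<comment> \<open>\<open>p\<close> is complemented within \<open>w\<close>, and \<open>v\<close>
    is disjoint from everything between \<open>0\<close> and \<open>w\<close>; so the positive part
    is all of \<open>p + v\<close>.\<close>
  also have "inf (p + v) (w - p) = 0"
    using root_part_complemented p
    by (intro inf_add_zero v_disjoint) (simp_all only: p_def diff_ge_0_iff_ge diff_le_eq le_add_same_cancel1)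
  finally have eq: "x = p + v" by simp
  have "inf p w' = 0" using p complement_nonneg by (intro inf_zero_mono[OF complement_disjoint]) auto
  then have "inf x w' = v" using inf_add_absorb[of v w' p] v p by (simp add: eq add.commute)
  then show "inf (r x) w' + inf (r x) w' = inf x w' + w'" by (simp add: v_def q_def)
  have "inf x w = p"
    unfolding eq using p v v_disjoint complement_nonneg by (intro inf_add_absorb) auto
  then show "inf (r x) w = inf x w" by (simp add: p_def)
qed

end

end

theorem theorem5p16:
  fixes M :: "'g::lattice_ab_group_add mv_structure"
    and u w :: 'g
    and r :: "'g \<Rightarrow> 'g"
  assumes "mv_algebra M"
    and "mv_square_root M r"
    and "strong_unit u"
    and "M = Gamma u"
    and "w = mv_times M (mv_neg M (r (mv_zero M))) (mv_neg M (r (mv_zero M)))"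
  shows "\<forall>x\<in>mv_carrier M.
           (\<exists>!h. h + h = inf x (mv_neg M w) + mv_neg M w) \<and>
           sup (inf x w) (group_half (inf x (mv_neg M w) + mv_neg M w)) \<in> mv_carrier M \<and>
           r x = sup (inf x w) (group_half (inf x (mv_neg M w) + mv_neg M w))"
proof
  interpret gamma_square_root u r
    using assms by unfold_locales (simp_all add: strong_unit_def)
  fix x assume "x \<in> mv_carrier M"
  then have x: "0 \<le> x" "x \<le> u" by (simp_all add: \<open>M = Gamma u\<close> Gamma_def)
  define w' where "w' = r 0 + r 0"
  have "w = mv_times (Gamma u) (u - r 0) (u - r 0)"
    using assms by (simp add: Gamma_def)
  also have "\<dots> = sup (u - w') 0"
    by (simp add: mv_times_Gamma w'_def algebra_simps)
  \<comment> \<open>The truncation at \<open>0\<close> has no effect because twice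
    \<open>r 0\<close> is at most \<open>u\<close>.\<close>
  finally have w: "w = u - w'"
    using twice_root_zero_le by (simp add: w'_def sup.absorb1)
  then have neg: "mv_neg M w = w'" by (simp add: \<open>M = Gamma u\<close> Gamma_def)
  note half = twice_inf_root[OF w'_def w x]
  have half_eq: "group_half (inf x w' + w') = inf (r x) w'" using half by (rule group_half_eq)
  have root: "r x = sup (inf x w) (group_half (inf x w' + w'))"
    unfolding half_eq using root_split(2)[OF w'_def w x] inf_root_complement[OF w'_def w x] by simp
  have "r x \<in> mv_carrier M"
    using root_nonneg[OF x] root_le_unit[OF x] by (simp add: \<open>M = Gamma u\<close> Gamma_def)
  moreover have "\<exists>!h. h + h = inf x w' + w'"
    using half by (rule ex1I) (metis half group_half_unique)
  ultimately show "(\<exists>!h. h + h = inf x (mv_neg M w) + mv_neg M w) \<and>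
      sup (inf x w) (group_half (inf x (mv_neg M w) + mv_neg M w)) \<in> mv_carrier M \<and>
      r x = sup (inf x w) (group_half (inf x (mv_neg M w) + mv_neg M w))"
    unfolding neg using root by simp
qed

end
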